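(* Let $N$ be a positive integer, let $A, B$ be integers with $0 \le A, B < N$, and put $X = A\cdot B$. Let $G$ and $H$ be positive integers with $G < H$ satisfying $$N^2 \le G\cdot H \quad\text{and}\quad G < N .$$ Define $\mu = \lfloor G\cdot H / N \rfloor$ and the estimated quotient $\hat Q = \big\lfloor \lfloor X/G \rfloor \cdot \mu / H \big\rfloor$, and let $Q = \lfloor X/N \rfloor$ be the actual quotient of $X$ divided by $N$. Then $|Q - \hat Q| \le 2$, i.e. the estimated quotient is at most $2$ away from the actual quotient.
   Context: $\lfloor y \rfloor$ denotes the floor (integer part) of a real number $y$. The quantity $\hat Q$ is the quotient estimate produced by a generalized Barrett algorithm in which the usual powers of two are replaced by arbitrary positive integers $G$ and $H$ (no coprimality of $G$ and $H$ is assumed). *)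

theory Defs
  imports Complex_Main
begin

end

theory Submission
  imports Defs
begin

text \<open>
  Write \<open>X = q G + r\<close> and \<open>G H = \<mu> N + s\<close> by division with remainder. Multiplying out,
  \<open>X G H = q \<mu> G N + s X + r \<mu> N\<close>. All error terms are nonnegative, so \<open>Q_hat \<le> Q\<close>; and
  \<open>s X\<close> and \<open>r \<mu> N\<close> are each at most \<open>N G H\<close> (using \<open>X \<le> N\<^sup>2 \<le> G H\<close> and \<open>r < G < N\<close>), so each
  contributes at most \<open>1\<close> to the error in \<open>X / N\<close>, and the outer floor contributes less than \<open>1\<close>.
\<close>

lemma barrett_quotient_bounds:
  fixes N X G H :: int
  assumes "N > 0" "0 \<le> X" "G > 0" "H > 0" "X \<le> G * H" "G \<le> N"
  defines "E \<equiv> (X div G) * (G * H div N) div H"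
  shows "E \<le> X div N" and "X div N \<le> E + 2"
proof -
  define q r m s where "q = X div G" "r = X mod G" "m = G * H div N" "s = G * H mod N"
  note defs = this
  have X: "X = q * G + r" and GH: "G * H = m * N + s"
    by (simp_all add: defs)
  have r: "0 \<le> r" "r < G" and s: "0 \<le> s" "s < N"
    using assms by (simp_all add: defs)
  have m: "0 \<le> m"
    using assms by (simp add: defs pos_imp_zdiv_nonneg_iff)
  have GH_pos: "0 < G * H"
    using assms by simp
  have E: "E = q * m div H"
    by (simp add: E_def defs)
  have "q * m = E * H + q * m mod H" "0 \<le> q * m mod H" "q * m mod H < H"
    using \<open>H > 0\<close> by (simp_all add: E)
  then have E_le: "E * H \<le> q * m" and E_gt: "q * m \<le> (E + 1) * H"
    unfolding distrib_right by linarith+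
  have "X * (m * N + s) = q * m * (G * N) + s * X + r * (m * N)"
    by (simp add: X algebra_simps)
  then have key: "X * (G * H) = q * m * (G * N) + s * X + r * (m * N)"
    by (simp add: GH)
  have GN: "0 \<le> G * N"
    using assms by simp
  \<comment> \<open>Scaled by \<open>G * H > 0\<close>, \<open>E * N \<le> X\<close> follows from
    \<open>key\<close> by dropping its two nonnegative error terms.\<close>
  have "E * N * (G * H) = E * H * (G * N)"
    by (simp add: algebra_simps)
  also have "\<dots> \<le> q * m * (G * N)"
    using E_le GN by (rule mult_right_mono)
  also have "\<dots> \<le> X * (G * H)"
    using key r s m assms by simp
  finally have "E * N \<le> X"
    using GH_pos by (rule mult_right_le_imp_le)
  then show "E \<le> X div N"
    using \<open>N > 0\<close> zdiv_mono1[of "E * N" X N] by simp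
  \<comment> \<open>Strict because \<open>s < N\<close>; this strictness carries through to
    \<open>X < (E + 3) * N\<close>.\<close>
  have "s * X < N * (G * H)"
  proof -
    have "s * X \<le> s * (G * H)"
      using assms(5) s(1) by (rule mult_left_mono)
    also have "\<dots> < N * (G * H)"
      using s(2) GH_pos by (rule mult_strict_right_mono)
    finally show ?thesis .
  qed
  \<comment> \<open>Expanding \<open>G * H\<close> as \<open>m * N + s\<close> reduces this to
    \<open>r \<le> N\<close> and \<open>m * N \<le> m * N + s\<close>.\<close>
  moreover have "r * (m * N) \<le> N * (G * H)"
    using r m s assms by (subst GH, intro mult_mono[of r N "m * N"]) simp_all
  moreover have "q * m * (G * N) \<le> (E + 1) * H * (G * N)"
    using E_gt GN by (rule mult_right_mono)
  \<comment> \<open>The 3 counts one unit of \<open>N * (G * H)\<close> each for the outer floor,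
    \<open>s * X\<close> and \<open>r * (m * N)\<close>; strictness then leaves 2 for
    integers.\<close>
  ultimately have "X * (G * H) < (E + 3) * N * (G * H)"
    unfolding key by (simp add: algebra_simps)
  then have "X < (E + 3) * N"
    using GH_pos by (simp only: mult_less_cancel_right_pos)
  moreover have "X div N * N \<le> X"
    using \<open>N > 0\<close> div_mult_mod_eq[of X N] pos_mod_sign[of N X] by linarith
  ultimately have "X div N * N < (E + 3) * N"
    by linarith
  then have "X div N < E + 3"
    using \<open>N > 0\<close> by (simp only: mult_less_cancel_right_pos)
  then show "X div N \<le> E + 2"
    by simp
qed

theorem theorem1:
  fixes N A B X G H \<mu> Q Q_hat :: int
  assumes "N > 0"
    and "0 \<le> A" and "A < N"
    and "0 \<le> B" and "B < N"
    and "X = A * B"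
    and "G > 0" and "H > 0" and "G < H"
    and "N ^ 2 \<le> G * H"
    and "G < N"
    and "\<mu> = \<lfloor>real_of_int (G * H) / real_of_int N\<rfloor>"
    and "Q_hat = \<lfloor>real_of_int (\<lfloor>real_of_int X / real_of_int G\<rfloor> * \<mu>) / real_of_int H\<rfloor>"
    and "Q = \<lfloor>real_of_int X / real_of_int N\<rfloor>"
  shows "\<bar>Q - Q_hat\<bar> \<le> 2"
proof -
  have "X \<le> N ^ 2"
    using assms(1-6) by (simp add: power2_eq_square mult_mono)
  then have "X \<le> G * H"
    using assms(10) by linarith
  moreover have "0 \<le> X"
    using assms(2,4,6) by simp
  \<comment> \<open>The floor of a real quotient of two integers is their \<open>div\<close>, so the
    bounds over \<open>int\<close> apply.\<close>
  moreover have "Q = X div N" "Q_hat = (X div G) * (G * H div N) div H"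
    unfolding assms(12-14) floor_divide_of_int_eq by (rule refl)+
  ultimately show ?thesis
    using barrett_quotient_bounds[of N X G H] assms(1,7,8,11) by simp
qed

end
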